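(* Let $\alpha,\beta,x,y,p\in\mathbb{C}$ with $\mathrm{Re}(x)>0$, $\mathrm{Re}(y)>0$, $\mathrm{Re}(\alpha)>-1$, $\mathrm{Re}(p)>0$. Then $${}^{\Psi}B_{p}^{(\alpha,\beta)}(x,y+1)+{}^{\Psi}B_{p}^{(\alpha,\beta)}(x+1,y)={}^{\Psi}B_{p}^{(\alpha,\beta)}(x,y).$$
   Context: For $\alpha,\beta\in\mathbb{C}$ with $\mathrm{Re}(\alpha)>-1$, the Wright function is ${}_{0}\Psi_{1}(\alpha,\beta;z)=\sum_{n=0}^{\infty}\frac{1}{\Gamma(\alpha n+\beta)}\frac{z^n}{n!}$ (with $1/\Gamma$ equal to $0$ at the poles of $\Gamma$). For $\mathrm{Re}(x)>0$, $\mathrm{Re}(y)>0$, $\mathrm{Re}(\alpha)>-1$, $\mathrm{Re}(p)>0$ the $\Psi$-beta function is $${}^{\Psi}B_{p}^{(\alpha,\beta)}(x,y)=\int_{0}^{1}t^{x-1}(1-t)^{y-1}\,{}_{0}\Psi_{1}\left(\alpha,\beta;-\frac{p}{t(1-t)}\right)dt.$$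
   Formalization: The formal theorem additionally assumes that the integral defining B(x,y) converges; the stated conditions do not ensure this (for α = β = x = y = 1, p = 1+i the integral diverges), and the identity has meaning exactly when it does. *)

theory Defs
  imports "HOL-Analysis.Analysis"
begin

(* rGamma is the entire function 1/Gamma, equal to 0 at the poles of Gamma. *)
definition Wright_Psi :: "complex \<Rightarrow> complex \<Rightarrow> complex \<Rightarrow> complex" where
  "Wright_Psi \<alpha> \<beta> z = (\<Sum>n. rGamma (\<alpha> * of_nat n + \<beta>) * (z ^ n / fact n))"

definition Psi_beta_integrand ::
  "complex \<Rightarrow> complex \<Rightarrow> complex \<Rightarrow> complex \<Rightarrow> complex \<Rightarrow> real \<Rightarrow> complex" where
  "Psi_beta_integrand \<alpha> \<beta> p x y t =
     of_real t powr (x - 1) * of_real (1 - t) powr (y - 1)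
       * Wright_Psi \<alpha> \<beta> (- p / of_real (t * (1 - t)))"

(* The integral is the Henstock-Kurzweil integral, which covers both absolutely convergent
   (Lebesgue) and conditionally convergent improper integrals.  The values of the integrand
   at the endpoints 0 and 1 are irrelevant to it. *)
definition Psi_beta ::
  "complex \<Rightarrow> complex \<Rightarrow> complex \<Rightarrow> complex \<Rightarrow> complex \<Rightarrow> complex" where
  "Psi_beta \<alpha> \<beta> p x y = integral {0..1} (Psi_beta_integrand \<alpha> \<beta> p x y)"

(* The conditions Re x > 0, Re y > 0, Re \<alpha> > -1, Re p > 0 do not by themselves make the
   integral converge: for \<alpha> = 1 the Wright function is a Bessel function, which grows
   exponentially along the ray of -p / (t (1 - t)) when p is not real.  Where the integral
   diverges, Psi_beta has the conventional value 0, so convergence has to be stated. *)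
definition Psi_beta_converges ::
  "complex \<Rightarrow> complex \<Rightarrow> complex \<Rightarrow> complex \<Rightarrow> complex \<Rightarrow> bool" where
  "Psi_beta_converges \<alpha> \<beta> p x y \<longleftrightarrow> Psi_beta_integrand \<alpha> \<beta> p x y integrable_on {0..1}"

end

theory Submission
  imports Defs
begin

text \<open>
  The integrand of \<open>Psi_beta\<close> at \<open>(x + 1, y)\<close> is \<open>t\<close> times the one at \<open>(x, y)\<close>, and at
  \<open>(x, y + 1)\<close> it is \<open>1 - t\<close> times that one; the relation is the integral of
  \<open>t + (1 - t) = 1\<close> against the integrand at \<open>(x, y)\<close>.

  Splitting the integral requires the two pieces to be integrable separately. The integral
  at \<open>(x, y)\<close> may converge only conditionally, so domination by the integrand at \<open>(x, y)\<close>
  does not give this. What does is Abel's principle: a monotone factor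
  preserves convergence, by the second mean value theorem (\<open>integrable_monotone_scaleR\<close>).
\<close>

text \<open>
  In each coordinate the second mean value theorem gives the integral of the product explicitly,
  in terms of two integrals of \<open>f\<close> over subintervals; it asks for no absolute integrability.
\<close>

lemma integrable_monotone_scaleR:
  fixes f :: "real \<Rightarrow> 'a::euclidean_space" and g :: "real \<Rightarrow> real"
  assumes f: "f integrable_on {a..b}" and ab: "a \<le> b" and g: "mono_on {a..b} g"
  shows "(\<lambda>t. g t *\<^sub>R f t) integrable_on {a..b}"
  unfolding integrable_componentwise_iff[of "\<lambda>t. g t *\<^sub>R f t"]
proof
  fix u :: 'a
  assume "u \<in> Basis"
  then have fu: "(\<lambda>t. f t \<bullet> u) integrable_on {a..b}"
    using f integrable_componentwise_iff by blast
  have "g s \<le> g t" if "a \<le> s" "s \<le> t" "t \<le> b" for s t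
    using mono_onD[OF g] that by simp
  then obtain c where "((\<lambda>t. g t * (f t \<bullet> u)) has_integral
      (g a * integral {a..c} (\<lambda>t. f t \<bullet> u) + g b * integral {c..b} (\<lambda>t. f t \<bullet> u))) {a..b}"
    using second_mean_value_theorem_full[OF fu ab, of g] by blast
  then show "(\<lambda>t. (g t *\<^sub>R f t) \<bullet> u) integrable_on {a..b}"
    by (auto simp: integrable_on_def)
qed

text \<open>
  The equation includes \<open>t = 0\<close>, where the convention \<open>0 powr w = 0\<close> makes both sides vanish;
  hence the relations between integrands below hold at every \<open>t\<close>, endpoints included.
\<close>

lemma of_real_powr_shift:
  fixes z :: complex
  shows "of_real t powr ((z + 1) - 1) = of_real t * of_real t powr (z - 1)"
  using powr_add[of "of_real t :: complex" "z - 1" 1] by simp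

lemma Psi_beta_integrand_shift_x:
  "Psi_beta_integrand \<alpha> \<beta> p (x + 1) y t = of_real t * Psi_beta_integrand \<alpha> \<beta> p x y t"
  unfolding Psi_beta_integrand_def of_real_powr_shift by (simp add: mult.assoc)

lemma Psi_beta_integrand_shift_y:
  "Psi_beta_integrand \<alpha> \<beta> p x (y + 1) t = of_real (1 - t) * Psi_beta_integrand \<alpha> \<beta> p x y t"
  unfolding Psi_beta_integrand_def of_real_powr_shift by (simp only: mult_ac)

theorem theorem2p4:
  fixes \<alpha> \<beta> x y p :: complex
  assumes "Re x > 0" and "Re y > 0" and "Re \<alpha> > -1" and "Re p > 0"
    and "Psi_beta_converges \<alpha> \<beta> p x y"
  shows "Psi_beta \<alpha> \<beta> p x (y + 1) + Psi_beta \<alpha> \<beta> p (x + 1) y = Psi_beta \<alpha> \<beta> p x y"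
proof -
  let ?f = "Psi_beta_integrand \<alpha> \<beta> p x y"
  have f: "?f integrable_on {0..1}"
    using assms(5) by (simp add: Psi_beta_converges_def)
  have tf: "(\<lambda>t. of_real t * ?f t) integrable_on {0..1}"
    using integrable_monotone_scaleR[OF f, of "\<lambda>t. t"]
    by (simp add: mono_on_def scaleR_conv_of_real)
  have "Psi_beta \<alpha> \<beta> p x (y + 1) = integral {0..1} (\<lambda>t. ?f t - of_real t * ?f t)"
    unfolding Psi_beta_def Psi_beta_integrand_shift_y by (simp add: left_diff_distrib)
  also have "\<dots> = integral {0..1} ?f - integral {0..1} (\<lambda>t. of_real t * ?f t)"
    by (rule integral_diff[OF f tf])
  also have "integral {0..1} (\<lambda>t. of_real t * ?f t) = Psi_beta \<alpha> \<beta> p (x + 1) y"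
    unfolding Psi_beta_def Psi_beta_integrand_shift_x ..
  finally show ?thesis
    by (simp add: Psi_beta_def)
qed

end
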